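(* Let $G=(V,E)$ be a connected locally finite graph with symmetric positive edge weights $\omega_{xy}=\omega_{yx}>0$ ($xy\in E$) and measure $\mu:V\to(0,\infty)$ satisfying $\mu(x)\ge\mu_{\min}$ for all $x\in V$, for some constant $\mu_{\min}>0$. Assume the potential $a:V\to\mathbb{R}$ satisfies: $(A_1)$ $\inf_{x\in V}a(x)\ge a_0$ for some constant $a_0\in(-1,0)$; $(A_2)$ for every $M>0$, the set $D_M=\{x\in V: a(x)\le M\}$ has finite volume, i.e. $\mathrm{Vol}(D_M)=\sum_{x\in D_M}\mu(x)<\infty$. Then the equation $-\Delta u+a(x)u=u\log u^2$ in $V$ admits a ground state solution.
   Context: A graph is locally finite if every vertex has finitely many neighbours; write $y\sim x$ if $xy\in E$. For $u,v:V\to\mathbb{R}$: $\int_V u\,d\mu=\sum_{x\in V}\mu(x)u(x)$; $\Delta u(x)=\frac1{\mu(x)}\sum_{y\sim x}\omega_{xy}(u(y)-u(x))$; $\Gamma(u,v)(x)=\frac1{2\mu(x)}\sum_{y\sim x}\omega_{xy}(u(y)-u(x))(v(y)-v(x))$; $|\nabla u|^2=\Gamma(u,u)$. The convention $0\log 0=0$ is used, so that $u\log u^2=u^2\log u^2=0$ where $u=0$. $C_c(V)$ is the set of functions with finite support, and $H^1(V)$ is the completion of $C_c(V)$ under $\|u\|_{H^1(V)}=\left(\int_V(|\nabla u|^2+u^2)\,d\mu\right)^{1/2}$ (regarded as a space of functions on $V$). Put $\mathcal H=\{u\in H^1(V):\int_V a(x)u^2\,d\mu<+\infty\}$ with norm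 $\|u\|_{\mathcal H}=\left(\int_V(|\nabla u|^2+(a(x)+1)u^2)\,d\mu\right)^{1/2}$, and $\mathcal D=\{u\in\mathcal H:\int_V u^2|\log u^2|\,d\mu<\infty\}$. For $u\in\mathcal D$ let $J(u)=\frac12\|u\|_{\mathcal H}^2-\frac12\int_V u^2\log u^2\,d\mu$, and for $u,v\in\mathcal D$ let $J'(u)\cdot v=\int_V(\Gamma(u,v)+a(x)uv)\,d\mu-\int_V uv\log u^2\,d\mu$. A weak solution of the equation (equivalently, a critical point of $J$) is a $u\in\mathcal D$ with $J'(u)\cdot v=0$ for all $v\in\mathcal D$. A ground state solution is a weak solution $u\ne0$ whose energy $J(u)$ is the minimum of $J$ over all nonzero weak solutions. *)

theory Defs
  imports "HOL-Analysis.Analysis"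
begin

text \<open>
  Functions on the vertex set are represented by total functions on the vertex type; since
  \<open>E \<subseteq> V \<times> V\<close>, every notion below depends only on their values on \<open>V\<close>.  An undirected edge
  \<open>xy\<close> is represented by the two pairs \<open>(x, y)\<close> and \<open>(y, x)\<close>.  Loops are not excluded, but they
  contribute nothing to the gradient form.
\<close>

locale weighted_graph =
  fixes V :: "'v set"
    and E :: "'v rel"
    and \<omega> :: "'v \<Rightarrow> 'v \<Rightarrow> real"
    and \<mu> :: "'v \<Rightarrow> real"
  assumes vertices_nonempty: "V \<noteq> {}"
    and edges_subset: "E \<subseteq> V \<times> V"
    and edges_sym: "sym E"
    and connected: "\<And>x y. x \<in> V \<Longrightarrow> y \<in> V \<Longrightarrow> (x, y) \<in> E\<^sup>*"
    and locally_finite: "\<And>x. x \<in> V \<Longrightarrow> finite {y. (x, y) \<in> E}"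
    and weight_sym: "\<And>x y. (x, y) \<in> E \<Longrightarrow> \<omega> x y = \<omega> y x"
    and weight_pos: "\<And>x y. (x, y) \<in> E \<Longrightarrow> \<omega> x y > 0"
    and measure_pos: "\<And>x. x \<in> V \<Longrightarrow> \<mu> x > 0"
begin

text \<open>
  Summability of a real family over a set is absolute summability, so \<open>integrable_V\<close> says that
  the integral over \<open>V\<close> converges absolutely.
\<close>

definition integrable_V :: "('v \<Rightarrow> real) \<Rightarrow> bool" where
  "integrable_V u \<longleftrightarrow> (\<lambda>x. \<mu> x * u x) summable_on V"

definition integral_V :: "('v \<Rightarrow> real) \<Rightarrow> real" where
  "integral_V u = (\<Sum>\<^sub>\<infinity>x\<in>V. \<mu> x * u x)"

definition \<Gamma> :: "('v \<Rightarrow> real) \<Rightarrow> ('v \<Rightarrow> real) \<Rightarrow> 'v \<Rightarrow> real" where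
  "\<Gamma> u v x = 1 / (2 * \<mu> x) * (\<Sum>y\<in>{y. (x, y) \<in> E}. \<omega> x y * (u y - u x) * (v y - v x))"

definition grad_sq :: "('v \<Rightarrow> real) \<Rightarrow> 'v \<Rightarrow> real" where
  "grad_sq u x = \<Gamma> u u x"

definition C_c :: "('v \<Rightarrow> real) set" where
  "C_c = {u. finite {x \<in> V. u x \<noteq> 0}}"

definition H1_norm :: "('v \<Rightarrow> real) \<Rightarrow> real" where
  "H1_norm u = sqrt (integral_V (\<lambda>x. grad_sq u x + (u x)\<^sup>2))"

text \<open>
  The functions of finite \<open>H1_norm\<close> form a Banach space (modulo values outside \<open>V\<close>) with continuous
  point evaluations, so the completion of \<open>C_c\<close>, as a space of functions, is the closure of
  \<open>C_c\<close> in it.  The integrability condition expresses that the norm of the difference is finite.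
\<close>

definition H1 :: "('v \<Rightarrow> real) set" where
  "H1 = {u. \<exists>\<phi> :: nat \<Rightarrow> 'v \<Rightarrow> real.
          (\<forall>n. \<phi> n \<in> C_c) \<and>
          (\<forall>n. integrable_V (\<lambda>x. grad_sq (\<lambda>z. \<phi> n z - u z) x + (\<phi> n x - u x)\<^sup>2)) \<and>
          (\<lambda>n. H1_norm (\<lambda>z. \<phi> n z - u z)) \<longlonglongrightarrow> 0}"

definition \<H> :: "('v \<Rightarrow> real) \<Rightarrow> ('v \<Rightarrow> real) set" where
  "\<H> a = {u \<in> H1. integrable_V (\<lambda>x. a x * (u x)\<^sup>2)}"

definition \<H>_norm :: "('v \<Rightarrow> real) \<Rightarrow> ('v \<Rightarrow> real) \<Rightarrow> real" where
  "\<H>_norm a u = sqrt (integral_V (\<lambda>x. grad_sq u x + (a x + 1) * (u x)\<^sup>2))"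

text \<open>
  The convention \<open>0 log 0 = 0\<close> is automatic below, as \<open>ln\<close> is total and always multiplied by a
  factor that vanishes where \<open>u\<close> does.
\<close>

definition \<D> :: "('v \<Rightarrow> real) \<Rightarrow> ('v \<Rightarrow> real) set" where
  "\<D> a = {u \<in> \<H> a. integrable_V (\<lambda>x. (u x)\<^sup>2 * \<bar>ln ((u x)\<^sup>2)\<bar>)}"

definition J :: "('v \<Rightarrow> real) \<Rightarrow> ('v \<Rightarrow> real) \<Rightarrow> real" where
  "J a u = 1 / 2 * (\<H>_norm a u)\<^sup>2 - 1 / 2 * integral_V (\<lambda>x. (u x)\<^sup>2 * ln ((u x)\<^sup>2))"

definition J' :: "('v \<Rightarrow> real) \<Rightarrow> ('v \<Rightarrow> real) \<Rightarrow> ('v \<Rightarrow> real) \<Rightarrow> real" where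
  "J' a u v = integral_V (\<lambda>x. \<Gamma> u v x + a x * u x * v x)
              - integral_V (\<lambda>x. u x * v x * ln ((u x)\<^sup>2))"

definition weak_solution :: "('v \<Rightarrow> real) \<Rightarrow> ('v \<Rightarrow> real) \<Rightarrow> bool" where
  "weak_solution a u \<longleftrightarrow> u \<in> \<D> a \<and> (\<forall>v\<in>\<D> a. J' a u v = 0)"

definition nonzero_on_V :: "('v \<Rightarrow> real) \<Rightarrow> bool" where
  "nonzero_on_V u \<longleftrightarrow> (\<exists>x\<in>V. u x \<noteq> 0)"

definition ground_state_solution :: "('v \<Rightarrow> real) \<Rightarrow> ('v \<Rightarrow> real) \<Rightarrow> bool" where
  "ground_state_solution a u \<longleftrightarrow>
     weak_solution a u \<and> nonzero_on_V u \<and>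
     (\<forall>w. weak_solution a w \<and> nonzero_on_V w \<longrightarrow> J a u \<le> J a w)"

end

end

theory Submission
  imports Defs "HOL-Complex_Analysis.Great_Picard"
begin

text \<open>
  Write \<open>N(u)\<close> for the integral of \<open>u\<^sup>2\<close> and \<open>Q(u)\<close> for the integral of
  \<open>\<bar>\<nabla>u\<bar>\<^sup>2 + a u\<^sup>2 - u\<^sup>2 ln u\<^sup>2\<close>; these are \<open>mass\<close> and \<open>log_energy\<close> below.  Then \<open>J = (Q + N) / 2\<close> and
  \<open>J'(u) u = Q(u)\<close>, so a weak solution \<open>u\<close> satisfies \<open>Q(u) = 0\<close> and \<open>J(u) = N(u) / 2\<close>.  The
  nonlinearity scales as \<open>Q(t u) = t\<^sup>2 (Q(u) - N(u) ln t\<^sup>2)\<close>.  If \<open>m\<close> is the infimum of \<open>Q\<close> over the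
  functions in \<open>\<D>\<close> with \<open>N = 1\<close>, then scaling gives \<open>Q(v) \<ge> N(v) (m - ln N(v))\<close> for all \<open>v\<close> in \<open>\<D>\<close>
  (\<open>log_energy_lower_bound\<close>).  Hence every nonzero weak solution has \<open>N \<ge> exp m\<close>, that is,
  \<open>J \<ge> exp m / 2\<close>, and it remains to find a weak solution that attains this bound.

  The infimum \<open>m\<close> is attained (\<open>unit_mass_minimiser_exists\<close>).  As the measure is at least \<open>\<mu>_min\<close>,
  functions of unit mass are bounded by \<open>1 / sqrt \<mu>_min\<close>, so \<open>ln u\<^sup>2\<close> is bounded above and, up to a
  multiple of \<open>N\<close>, \<open>Q\<close> is an integral of nonnegative terms.  Moreover the sublevel sets of \<open>a\<close>, having
  finite volume, are finite.  So \<open>V\<close> is countable, a minimising sequence has a pointwise convergent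
  subsequence, no mass is lost in the limit (\<open>mass_on_sublevel\<close>), and Fatou's lemma bounds \<open>Q\<close> of the
  limit by \<open>m\<close>.  That the limit lies in the closure of the finitely supported functions is not a
  question of weak compactness here: by truncation every function of finite norm does (\<open>H1_iff\<close>).

  Differentiating the lower bound at the minimiser \<open>u\<close> gives \<open>J'(u) \<phi> = m \<integral> u \<phi>\<close> for finitely supported
  \<open>\<phi>\<close> (\<open>euler_lagrange\<close>).  The multiple \<open>exp (m / 2) u\<close> absorbs the multiplier \<open>m\<close> and has mass
  \<open>exp m\<close>.  A final truncation argument extends the equation from finitely supported test functions to
  all of \<open>\<D>\<close> (\<open>J'_eq_0_if_C_c\<close>).
\<close>

section \<open>Limits under sums over a set\<close>

text \<open>
  Only finite partial sums are passed to the limit: they are dominated by the full sums because the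
  terms are nonnegative, and they determine the sum of the limit.
\<close>

lemma infsum_fatou:
  fixes f :: "nat \<Rightarrow> 'a \<Rightarrow> real"
  assumes summ: "\<And>n. f n summable_on A"
    and nonneg: "\<And>n x. x \<in> A \<Longrightarrow> 0 \<le> f n x"
    and lim: "\<And>x. x \<in> A \<Longrightarrow> (\<lambda>n. f n x) \<longlonglongrightarrow> g x"
    and le: "\<And>n. infsum (f n) A \<le> c n" and c: "c \<longlonglongrightarrow> C"
  shows "g summable_on A" "infsum g A \<le> C"
proof -
  have fin: "sum g F \<le> C" if F: "finite F" "F \<subseteq> A" for F
  proof (rule LIMSEQ_le[OF _ c])
    show "(\<lambda>n. sum (f n) F) \<longlonglongrightarrow> sum g F"
      using F by (intro tendsto_sum lim) auto
    have "sum (f n) F \<le> c n" for n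
      by (rule order_trans[OF finite_sum_le_infsum[OF summ F] le]) (use nonneg in auto)
    then show "\<exists>N. \<forall>n\<ge>N. sum (f n) F \<le> c n" by blast
  qed
  have g_nonneg: "0 \<le> g x" if "x \<in> A" for x
    by (rule LIMSEQ_le_const[OF lim[OF that]]) (use nonneg that in auto)
  show "g summable_on A"
    by (rule nonneg_bdd_above_summable_on) (auto intro!: bdd_aboveI[where M = C] fin g_nonneg)
  then show "infsum g A \<le> C"
    by (rule infsum_le_finite_sums) (rule fin)
qed

lemma infsum_dominated_convergence:
  fixes f :: "nat \<Rightarrow> 'a \<Rightarrow> real"
  assumes g: "g summable_on A"
    and dom: "\<And>n x. x \<in> A \<Longrightarrow> \<bar>f n x\<bar> \<le> g x"
    and lim: "\<And>x. x \<in> A \<Longrightarrow> (\<lambda>n. f n x) \<longlonglongrightarrow> h x"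
  shows "(\<lambda>n. infsum (f n) A) \<longlonglongrightarrow> infsum h A"
proof -
  have eq: "infsum k A = integral\<^sup>L (count_space A) k" if "\<And>x. x \<in> A \<Longrightarrow> \<bar>k x\<bar> \<le> g x" for k
  proof -
    have "Infinite_Set_Sum.abs_summable_on k A"
      using Infinite_Sum.abs_summable_on_comparison_test'[OF g, of k] that
      by (simp add: abs_summable_equivalent[symmetric])
    from infsetsum_infsum[OF this] show ?thesis by (simp add: infsetsum_def)
  qed
  have h_le: "\<bar>h x\<bar> \<le> g x" if "x \<in> A" for x
    by (rule LIMSEQ_le_const2[OF tendsto_rabs[OF lim[OF that]]]) (use dom that in auto)
  have "integrable (count_space A) g"
    using summable_on_iff_abs_summable_on_real[THEN iffD1, OF g]
    unfolding abs_summable_equivalent Infinite_Set_Sum.abs_summable_on_def .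
  then have "(\<lambda>n. integral\<^sup>L (count_space A) (f n)) \<longlonglongrightarrow> integral\<^sup>L (count_space A) h"
    by (rule integral_dominated_convergence[where w = g, rotated 2])
       (auto simp: AE_count_space intro: lim dom)
  then show ?thesis
    using eq dom h_le by simp
qed

lemma finite_if_summable_bounded_below:
  fixes f :: "'a \<Rightarrow> real"
  assumes f: "f summable_on S" and c: "c > 0" "\<And>x. x \<in> S \<Longrightarrow> c \<le> f x"
  shows "finite S"
proof (rule ccontr)
  assume "infinite S"
  have "(\<lambda>_. c) summable_on S"
    by (rule summable_on_comparison_test[OF f]) (use c in auto)
  obtain k :: nat where k: "infsum f S < real k * c"
    using c(1) reals_Archimedean3 by blast
  obtain F where F: "F \<subseteq> S" "finite F" "card F = k"
    using infinite_arbitrarily_large[OF \<open>infinite S\<close>] by blast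
  have "real k * c = (\<Sum>x\<in>F. c)" using F by simp
  also have "\<dots> \<le> sum f F" using F c by (intro sum_mono) auto
  also have "\<dots> \<le> infsum f S"
    using F c by (intro finite_sum_le_infsum[OF f]) (auto intro: order_trans[OF less_imp_le])
  finally show False using k by simp
qed

section \<open>Integration and the gradient form\<close>

context weighted_graph
begin

lemma integrable_V_add:
  "integrable_V f \<Longrightarrow> integrable_V g \<Longrightarrow> integrable_V (\<lambda>x. f x + g x)"
  by (simp add: integrable_V_def distrib_left summable_on_add)

lemma integral_V_add:
  "integrable_V f \<Longrightarrow> integrable_V g \<Longrightarrow>
    integral_V (\<lambda>x. f x + g x) = integral_V f + integral_V g"
  by (simp add: integrable_V_def integral_V_def distrib_left infsum_add)

lemma integrable_V_cmult: "integrable_V f \<Longrightarrow> integrable_V (\<lambda>x. c * f x)"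
  using summable_on_cmult_right[of "\<lambda>x. \<mu> x * f x" V c]
  by (simp add: integrable_V_def mult.left_commute)

lemma integral_V_cmult: "integral_V (\<lambda>x. c * f x) = c * integral_V f"
  by (simp add: integral_V_def mult.left_commute[of _ c] infsum_cmult_right')

lemma integrable_V_diff:
  "integrable_V f \<Longrightarrow> integrable_V g \<Longrightarrow> integrable_V (\<lambda>x. f x - g x)"
  using integrable_V_add[of f "\<lambda>x. - 1 * g x"] integrable_V_cmult[of g "-1"] by simp

lemma integral_V_diff:
  "integrable_V f \<Longrightarrow> integrable_V g \<Longrightarrow>
    integral_V (\<lambda>x. f x - g x) = integral_V f - integral_V g"
  using integral_V_add[of f "\<lambda>x. - 1 * g x"] integrable_V_cmult[of g "-1"]
    integral_V_cmult[of "-1" g] by simp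

lemma integral_V_cong:
  "(\<And>x. x \<in> V \<Longrightarrow> f x = g x) \<Longrightarrow> integral_V f = integral_V g"
  unfolding integral_V_def by (intro infsum_cong) simp

lemma integrable_V_bound:
  assumes "integrable_V g" "\<And>x. x \<in> V \<Longrightarrow> \<bar>f x\<bar> \<le> g x"
  shows "integrable_V f"
  using Infinite_Sum.abs_summable_on_comparison_test'[of "\<lambda>x. \<mu> x * g x" V "\<lambda>x. \<mu> x * f x"] assms measure_pos
  unfolding integrable_V_def summable_on_iff_abs_summable_on_real[of "\<lambda>x. \<mu> x * f x"]
  by (simp add: abs_mult less_imp_le mult_left_mono)

lemma integrable_V_abs_iff: "integrable_V (\<lambda>x. \<bar>f x\<bar>) \<longleftrightarrow> integrable_V f"
proof
  assume "integrable_V f"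
  then have "(\<lambda>x. \<bar>\<mu> x * f x\<bar>) summable_on V"
    unfolding integrable_V_def summable_on_iff_abs_summable_on_real[of "\<lambda>x. \<mu> x * f x"] by simp
  then show "integrable_V (\<lambda>x. \<bar>f x\<bar>)"
    unfolding integrable_V_def
    by (rule summable_on_cong[THEN iffD1, rotated]) (simp add: abs_mult measure_pos less_imp_le)
qed (auto intro: integrable_V_bound)

lemma integral_V_mono:
  assumes "integrable_V f" "integrable_V g" "\<And>x. x \<in> V \<Longrightarrow> f x \<le> g x"
  shows "integral_V f \<le> integral_V g"
  using assms measure_pos unfolding integrable_V_def integral_V_def
  by (intro infsum_mono) (auto intro!: mult_left_mono less_imp_le)

lemma integral_V_nonneg:
  "(\<And>x. x \<in> V \<Longrightarrow> 0 \<le> f x) \<Longrightarrow> 0 \<le> integral_V f"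
  unfolding integral_V_def using measure_pos by (intro infsum_nonneg) (simp add: less_imp_le)

lemma sum_le_integral_V:
  assumes "integrable_V f" "finite F" "F \<subseteq> V" "\<And>x. x \<in> V \<Longrightarrow> 0 \<le> f x"
  shows "(\<Sum>x\<in>F. \<mu> x * f x) \<le> integral_V f"
  using assms measure_pos unfolding integrable_V_def integral_V_def
  by (intro finite_sum_le_infsum) (auto simp: less_imp_le)

lemma integrable_V_finite_support: "f \<in> C_c \<Longrightarrow> integrable_V f"
  unfolding integrable_V_def C_c_def
  by (intro finite_nonzero_values_imp_summable_on) (auto elim: rev_finite_subset)

lemma integral_V_finite_support:
  assumes "finite F" "F \<subseteq> V" "\<And>x. x \<in> V - F \<Longrightarrow> f x = 0"
  shows "integral_V f = (\<Sum>x\<in>F. \<mu> x * f x)"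
proof -
  have "integral_V f = infsum (\<lambda>x. \<mu> x * f x) F"
    unfolding integral_V_def by (rule infsum_cong_neutral) (use assms in auto)
  then show ?thesis using assms by simp
qed

lemma C_c_mono: "u \<in> C_c \<Longrightarrow> (\<And>x. x \<in> V \<Longrightarrow> u x = 0 \<Longrightarrow> f x = 0) \<Longrightarrow> f \<in> C_c"
  unfolding C_c_def by (auto elim!: rev_finite_subset)

lemma integral_V_dominated_convergence:
  assumes "integrable_V g" "\<And>n x. x \<in> V \<Longrightarrow> \<bar>f n x\<bar> \<le> g x"
    "\<And>x. x \<in> V \<Longrightarrow> (\<lambda>n. f n x) \<longlonglongrightarrow> h x"
  shows "(\<lambda>n. integral_V (f n)) \<longlonglongrightarrow> integral_V h"
  unfolding integral_V_def
  by (rule infsum_dominated_convergence[where g = "\<lambda>x. \<mu> x * g x"])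
     (use assms measure_pos in \<open>auto simp: integrable_V_def abs_mult less_imp_le
        intro!: mult_left_mono tendsto_mult_left\<close>)

lemma integral_V_fatou:
  assumes "\<And>n. integrable_V (f n)" "\<And>n x. x \<in> V \<Longrightarrow> 0 \<le> f n x"
    "\<And>x. x \<in> V \<Longrightarrow> (\<lambda>n. f n x) \<longlonglongrightarrow> g x"
    "\<And>n. integral_V (f n) \<le> c n" "c \<longlonglongrightarrow> C"
  shows "integrable_V g" "integral_V g \<le> C"
  unfolding integral_V_def integrable_V_def
  by (rule infsum_fatou[where f = "\<lambda>n x. \<mu> x * f n x" and c = c];
      use assms measure_pos in \<open>auto simp: integrable_V_def integral_V_def less_imp_le
        intro!: tendsto_mult_left\<close>)+

lemma neighbour_in_V: "(x, y) \<in> E \<Longrightarrow> x \<in> V \<and> y \<in> V"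
  using edges_subset by auto

lemma grad_sq_add:
  "grad_sq (\<lambda>z. u z + s * v z) x = grad_sq u x + 2 * s * \<Gamma> u v x + s\<^sup>2 * grad_sq v x"
proof -
  have "(\<Sum>y\<in>{y. (x, y) \<in> E}. \<omega> x y * (u y + s * v y - (u x + s * v x)) * (u y + s * v y - (u x + s * v x)))
    = (\<Sum>y\<in>{y. (x, y) \<in> E}. \<omega> x y * (u y - u x) * (u y - u x))
      + 2 * s * (\<Sum>y\<in>{y. (x, y) \<in> E}. \<omega> x y * (u y - u x) * (v y - v x))
      + s\<^sup>2 * (\<Sum>y\<in>{y. (x, y) \<in> E}. \<omega> x y * (v y - v x) * (v y - v x))"
    unfolding sum_distrib_left sum.distrib[symmetric]
    by (intro sum.cong refl) (simp add: power2_eq_square algebra_simps)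
  then show ?thesis
    unfolding grad_sq_def \<Gamma>_def by (simp only: distrib_left mult.left_commute mult.assoc)
qed

lemma \<Gamma>_scale_left: "\<Gamma> (\<lambda>z. t * u z) v x = t * \<Gamma> u v x"
  unfolding \<Gamma>_def sum_distrib_left by (intro sum.cong refl) (simp add: algebra_simps)

lemma grad_sq_scale: "grad_sq (\<lambda>z. t * u z) x = t\<^sup>2 * grad_sq u x"
  unfolding grad_sq_def \<Gamma>_def sum_distrib_left
  by (intro sum.cong refl) (simp add: algebra_simps power2_eq_square)

lemma grad_sq_mono:
  assumes "x \<in> V" "\<And>y. \<bar>u y - u x\<bar> \<le> \<bar>v y - v x\<bar>"
  shows "grad_sq u x \<le> grad_sq v x"
proof -
  have "\<omega> x y * (u y - u x) * (u y - u x) \<le> \<omega> x y * (v y - v x) * (v y - v x)" if "(x, y) \<in> E" for y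
    using mult_left_mono[OF power_mono[OF assms(2)[of y] abs_ge_zero, of 2], of "\<omega> x y"]
      weight_pos[OF that] by (simp add: power2_eq_square mult.assoc)
  then show ?thesis
    unfolding grad_sq_def \<Gamma>_def using measure_pos[OF assms(1)]
    by (intro mult_left_mono sum_mono) auto
qed

lemma grad_sq_nonneg: "x \<in> V \<Longrightarrow> 0 \<le> grad_sq u x"
  using grad_sq_mono[of x "\<lambda>_. 0" u] by (simp add: grad_sq_def \<Gamma>_def)

text \<open>
  Both gradient densities of \<open>u + v\<close> and \<open>u - v\<close> are nonnegative, and their mixed terms have
  opposite signs.  This bound replaces the Cauchy--Schwarz inequality throughout.
\<close>

lemma abs_\<Gamma>_le:
  assumes "x \<in> V"
  shows "\<bar>\<Gamma> u v x\<bar> \<le> (grad_sq u x + grad_sq v x) / 2"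
  using grad_sq_add[of u 1 v x] grad_sq_add[of u "-1" v x]
    grad_sq_nonneg[OF assms, of "\<lambda>z. u z + 1 * v z"] grad_sq_nonneg[OF assms, of "\<lambda>z. u z + (-1) * v z"]
  by (simp add: abs_le_iff field_simps)

lemma \<Gamma>_tendsto:
  assumes "x \<in> V"
    and "\<And>z. z \<in> V \<Longrightarrow> (\<lambda>n. u n z) \<longlonglongrightarrow> u' z" "\<And>z. z \<in> V \<Longrightarrow> (\<lambda>n. v n z) \<longlonglongrightarrow> v' z"
  shows "(\<lambda>n. \<Gamma> (u n) (v n) x) \<longlonglongrightarrow> \<Gamma> u' v' x"
  unfolding \<Gamma>_def using assms neighbour_in_V
  by (intro tendsto_mult tendsto_sum tendsto_diff tendsto_const) auto

lemma \<Gamma>_finite_support: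
  assumes "v \<in> C_c"
  shows "\<Gamma> u v \<in> C_c"
proof -
  let ?S = "{x \<in> V. v x \<noteq> 0}"
  have "{x \<in> V. \<Gamma> u v x \<noteq> 0} \<subseteq> ?S \<union> (\<Union>z\<in>?S. {y. (z, y) \<in> E})"
  proof
    fix x assume "x \<in> {x \<in> V. \<Gamma> u v x \<noteq> 0}"
    then have x: "x \<in> V" "\<Gamma> u v x \<noteq> 0" by auto
    then have "\<exists>y. (x, y) \<in> E \<and> v y \<noteq> v x"
      unfolding \<Gamma>_def by (metis (mono_tags, lifting) diff_self mem_Collect_eq mult_zero_right sum.neutral)
    then obtain y where "(x, y) \<in> E" "v y \<noteq> v x" by blast
    then show "x \<in> ?S \<union> (\<Union>z\<in>?S. {y. (z, y) \<in> E})"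
      using x neighbour_in_V[of x y] symD[OF edges_sym] by auto
  qed
  moreover have "finite (?S \<union> (\<Union>z\<in>?S. {y. (z, y) \<in> E}))"
    using assms locally_finite by (auto simp: C_c_def)
  ultimately show ?thesis unfolding C_c_def using finite_subset by auto
qed

lemma integrable_V_\<Gamma>:
  assumes "integrable_V (grad_sq u)" "integrable_V (grad_sq v)"
  shows "integrable_V (\<Gamma> u v)"
  using integrable_V_bound[OF integrable_V_cmult[OF integrable_V_add[OF assms], of "1/2"]] abs_\<Gamma>_le
  by simp

end

section \<open>Truncation\<close>

text \<open>
  Soft thresholding: values are moved towards zero by \<open>1 / (n + 1)\<close>, and values below this
  threshold become zero.  In contrast to cutting off a function outside a large finite set, this map
  and its difference to the identity are both contractions, so that neither \<open>shrink n \<circ> u\<close> nor the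
  error \<open>shrink n \<circ> u - u\<close> has a larger gradient than \<open>u\<close> at any vertex.
\<close>

definition shrink :: "nat \<Rightarrow> real \<Rightarrow> real" where
  "shrink n r = r - max (- inverse (real (Suc n))) (min (inverse (real (Suc n))) r)"

lemma shrink_contraction:
  "\<bar>shrink n r - shrink n s\<bar> \<le> \<bar>r - s\<bar>"
  "\<bar>(shrink n r - r) - (shrink n s - s)\<bar> \<le> \<bar>r - s\<bar>"
  "\<bar>shrink n r\<bar> \<le> \<bar>r\<bar>"
  "\<bar>shrink n r - r\<bar> \<le> \<bar>r\<bar>"
proof -
  have "0 < inverse (real (Suc n))" by simp
  then show "\<bar>shrink n r - shrink n s\<bar> \<le> \<bar>r - s\<bar>"
  "\<bar>(shrink n r - r) - (shrink n s - s)\<bar> \<le> \<bar>r - s\<bar>"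
  "\<bar>shrink n r\<bar> \<le> \<bar>r\<bar>"
  "\<bar>shrink n r - r\<bar> \<le> \<bar>r\<bar>"
    unfolding shrink_def by linarith+
qed

lemma shrink_nonzero: "shrink n r \<noteq> 0 \<Longrightarrow> inverse (real (Suc n)) \<le> \<bar>r\<bar>"
  unfolding shrink_def by linarith

lemma shrink_tendsto: "(\<lambda>n. shrink n r) \<longlonglongrightarrow> r"
proof -
  have "(\<lambda>n. max (- inverse (real (Suc n))) (min (inverse (real (Suc n))) r)) \<longlonglongrightarrow> max (- 0) (min 0 r)"
    by (intro tendsto_max tendsto_min tendsto_minus tendsto_const LIMSEQ_inverse_real_of_nat)
  then have "(\<lambda>n. r - max (- inverse (real (Suc n))) (min (inverse (real (Suc n))) r)) \<longlonglongrightarrow> r - max (- 0) (min 0 r)"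
    by (intro tendsto_diff tendsto_const)
  then show ?thesis unfolding shrink_def by simp
qed

section \<open>The entropy function\<close>

lemma abs_mult_le_sum_squares: "\<bar>s * t\<bar> \<le> s\<^sup>2 + t\<^sup>2" for s t :: real
proof -
  have "2 * (\<bar>s\<bar> * \<bar>t\<bar>) \<le> s\<^sup>2 + t\<^sup>2"
    using sum_squares_bound[of "\<bar>s\<bar>" "\<bar>t\<bar>"] by (simp add: mult.assoc)
  moreover have "0 \<le> \<bar>s\<bar> * \<bar>t\<bar>" by simp
  ultimately show ?thesis unfolding abs_mult by linarith
qed

text \<open>
  This makes the derivative \<open>J'\<close> absolutely convergent.  If \<open>\<bar>t\<bar> \<le> \<bar>s\<bar>\<close>, the first term on the right
  suffices.  Otherwise the logarithm of \<open>s\<^sup>2\<close> is compared with that of \<open>t\<^sup>2\<close>; the ratio \<open>r = \<bar>s\<bar> / \<bar>t\<bar>\<close> lies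
  below 1, and \<open>r * \<bar>ln r\<bar> \<le> 1\<close> accounts for the last term.
\<close>

lemma abs_mult_ln_le:
  fixes s t :: real
  shows "\<bar>s * t * ln (s\<^sup>2)\<bar> \<le> s\<^sup>2 * \<bar>ln (s\<^sup>2)\<bar> + t\<^sup>2 * \<bar>ln (t\<^sup>2)\<bar> + 2 * t\<^sup>2"
proof (cases "\<bar>t\<bar> \<le> \<bar>s\<bar>")
  case True
  then have "\<bar>s\<bar> * \<bar>t\<bar> \<le> s\<^sup>2"
    using mult_left_mono[of "\<bar>t\<bar>" "\<bar>s\<bar>" "\<bar>s\<bar>"] by (simp add: power2_eq_square abs_mult_self_eq)
  then have "\<bar>s * t * ln (s\<^sup>2)\<bar> \<le> s\<^sup>2 * \<bar>ln (s\<^sup>2)\<bar>"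
    by (simp add: abs_mult mult_right_mono)
  moreover have "0 \<le> t\<^sup>2 * \<bar>ln (t\<^sup>2)\<bar>" by simp
  ultimately show ?thesis
    using zero_le_power2[of t] by linarith
next
  case False
  show ?thesis
  proof (cases "s = 0")
    case False
    define p q where "p = \<bar>s\<bar>" and "q = \<bar>t\<bar>"
    have pq: "0 < p" "p < q" using \<open>s \<noteq> 0\<close> \<open>\<not> \<bar>t\<bar> \<le> \<bar>s\<bar>\<close> by (auto simp: p_def q_def)
    have sq: "s\<^sup>2 = p\<^sup>2" "t\<^sup>2 = q\<^sup>2" by (simp_all add: p_def q_def)
    have lns: "ln (p\<^sup>2) = 2 * ln p" "ln (q\<^sup>2) = 2 * ln q"
      using pq by (simp_all add: ln_realpow)
    have "ln (q / p) \<le> q / p - 1" using pq by (intro ln_le_minus_one) simp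
    then have "p * ln (q / p) \<le> p * (q / p - 1)" using pq by (intro mult_left_mono) auto
    also have "\<dots> \<le> q" using pq by (simp add: field_simps)
    finally have l1: "p * (ln q - ln p) \<le> q" using pq by (simp add: ln_div)
    have "ln p < ln q" using pq by simp
    then have "\<bar>ln p\<bar> \<le> \<bar>ln q\<bar> + (ln q - ln p)" by linarith
    then have "p * q * (2 * \<bar>ln p\<bar>) \<le> p * q * (2 * (\<bar>ln q\<bar> + (ln q - ln p)))"
      using pq by (intro mult_left_mono) auto
    also have "\<dots> = p * q * (2 * \<bar>ln q\<bar>) + 2 * q * (p * (ln q - ln p))"
      by (simp add: algebra_simps)
    also have "\<dots> \<le> q * q * (2 * \<bar>ln q\<bar>) + 2 * q * q"
      using pq l1 by (intro add_mono mult_right_mono mult_left_mono) auto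
    finally have "p * q * (2 * \<bar>ln p\<bar>) \<le> q\<^sup>2 * \<bar>ln (q\<^sup>2)\<bar> + 2 * q\<^sup>2"
      unfolding lns by (simp add: power2_eq_square abs_mult)
    moreover have "\<bar>s * t * ln (s\<^sup>2)\<bar> = p * q * (2 * \<bar>ln p\<bar>)"
      using pq by (simp add: sq lns abs_mult p_def[symmetric] q_def[symmetric])
    moreover have "0 \<le> s\<^sup>2 * \<bar>ln (s\<^sup>2)\<bar>" by simp
    ultimately show ?thesis unfolding sq by linarith
  qed simp
qed

text \<open>
  With \<open>\<bar>s\<bar> = r\<^sup>2\<close>, the elementary bound \<open>- ln r \<le> 1 / r\<close> loses only one of the two factors \<open>r\<close>.
\<close>

lemma mult_ln_square_tendsto_0: "((\<lambda>s::real. s * ln (s\<^sup>2)) \<longlongrightarrow> 0) (at 0)"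
proof (rule Lim_null_comparison)
  show "((\<lambda>s::real. 4 * sqrt \<bar>s\<bar>) \<longlongrightarrow> 0) (at 0)"
    by (auto intro!: tendsto_eq_intros)
  have "norm (s * ln (s\<^sup>2)) \<le> 4 * sqrt \<bar>s\<bar>" if s: "s \<noteq> 0" "\<bar>s\<bar> < 1" for s :: real
  proof -
    define r where "r = sqrt \<bar>s\<bar>"
    have r: "0 < r" "r < 1" "\<bar>s\<bar> = r\<^sup>2" using s by (simp_all add: r_def)
    have "s\<^sup>2 = r ^ 4" using arg_cong[OF r(3), of "\<lambda>x. x\<^sup>2"] by simp
    then have l: "ln (s\<^sup>2) = 4 * ln r" using r by (simp add: ln_realpow)
    have "ln (1 / r) \<le> 1 / r - 1" using r by (intro ln_le_minus_one) simp
    then have "- ln r \<le> 1 / r" using r by (simp add: ln_div)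
    then have "r\<^sup>2 * (4 * - ln r) \<le> r\<^sup>2 * (4 * (1 / r))"
      using r by (intro mult_left_mono) auto
    also have "\<dots> = 4 * r" using r by (simp add: power2_eq_square)
    finally have "r\<^sup>2 * (4 * - ln r) \<le> 4 * r" .
    moreover have "ln r < 0" using r by simp
    moreover have "norm (s * ln (s\<^sup>2)) = r\<^sup>2 * \<bar>4 * ln r\<bar>"
      by (simp only: real_norm_def abs_mult l r(3))
    moreover have "\<bar>4 * ln r\<bar> = 4 * - ln r"
      using \<open>ln r < 0\<close> by linarith
    ultimately have "norm (s * ln (s\<^sup>2)) \<le> 4 * r"
      by (simp only:)
    then show ?thesis by (simp only: r_def)
  qed
  then show "\<forall>\<^sub>F s::real in at 0. norm (s * ln (s\<^sup>2)) \<le> 4 * sqrt \<bar>s\<bar>"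
    unfolding eventually_at by (intro exI[of _ 1]) auto
qed

text \<open>
  The difference quotient at \<open>t = 0\<close> is \<open>h * ln (h\<^sup>2)\<close>, which tends to zero.  A minimiser is not known to be
  nonzero at every vertex, so this case is needed for the Euler--Lagrange equation.
\<close>

lemma DERIV_square_ln_square:
  "((\<lambda>t::real. t\<^sup>2 * ln (t\<^sup>2)) has_real_derivative 2 * t * ln (t\<^sup>2) + 2 * t) (at t)"
proof (cases "t = 0")
  case True
  have "((\<lambda>h::real. ((0 + h)\<^sup>2 * ln ((0 + h)\<^sup>2) - 0\<^sup>2 * ln (0\<^sup>2)) / h) \<longlongrightarrow> 0) (at 0)"
    by (rule Lim_transform_eventually[OF mult_ln_square_tendsto_0])
       (auto simp: eventually_at power2_eq_square intro!: exI[of _ 1])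
  then show ?thesis using True by (simp add: DERIV_def)
next
  case False
  then show ?thesis
    by (auto intro!: derivative_eq_intros simp: power2_eq_square zero_less_mult_iff linorder_neq_iff)
qed

lemma square_ln_square_mult:
  fixes r t :: real
  assumes "t \<noteq> 0"
  shows "(t * r)\<^sup>2 * ln ((t * r)\<^sup>2) = t\<^sup>2 * (r\<^sup>2 * ln (r\<^sup>2)) + t\<^sup>2 * ln (t\<^sup>2) * r\<^sup>2"
  using assms by (cases "r = 0") (simp_all add: power_mult_distrib ln_mult algebra_simps)

section \<open>Functions of finite energy\<close>

context weighted_graph
begin

lemma integrable_V_grad_sq_add:
  assumes "integrable_V (grad_sq u)" "integrable_V (grad_sq v)"
  shows "integrable_V (grad_sq (\<lambda>z. u z + s * v z))"
proof -
  have "integrable_V (\<lambda>x. grad_sq u x + 2 * s * \<Gamma> u v x + s\<^sup>2 * grad_sq v x)"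
    by (intro integrable_V_add integrable_V_cmult integrable_V_\<Gamma> assms)
  then show ?thesis by (simp add: grad_sq_add[symmetric])
qed

lemma integrable_V_mult:
  assumes "integrable_V (\<lambda>x. (u x)\<^sup>2)" "integrable_V (\<lambda>x. (v x)\<^sup>2)"
  shows "integrable_V (\<lambda>x. u x * v x)"
  by (rule integrable_V_bound[OF integrable_V_add[OF assms] abs_mult_le_sum_squares])

lemma integrable_V_square_add:
  assumes "integrable_V (\<lambda>x. (u x)\<^sup>2)" "integrable_V (\<lambda>x. (v x)\<^sup>2)"
  shows "integrable_V (\<lambda>x. (u x + s * v x)\<^sup>2)"
proof -
  have "integrable_V (\<lambda>x. (u x)\<^sup>2 + 2 * s * (u x * v x) + s\<^sup>2 * (v x)\<^sup>2)"
    by (intro integrable_V_add integrable_V_cmult integrable_V_mult assms)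
  moreover have "(\<lambda>x. (u x)\<^sup>2 + 2 * s * (u x * v x) + s\<^sup>2 * (v x)\<^sup>2) = (\<lambda>x. (u x + s * v x)\<^sup>2)"
    by (simp add: power2_eq_square algebra_simps)
  ultimately show ?thesis by simp
qed

text \<open>
  A uniform lower bound on the measure forces a square-integrable function to tend to zero at
  infinity: only finitely many values can lie above a positive threshold.
\<close>

lemma shrink_in_C_c:
  assumes m: "m > 0" "\<And>x. x \<in> V \<Longrightarrow> m \<le> \<mu> x" and u: "integrable_V (\<lambda>x. (u x)\<^sup>2)"
  shows "(\<lambda>x. shrink n (u x)) \<in> C_c"
proof -
  let ?d = "inverse (real (Suc n))" and ?S = "{x \<in> V. shrink n (u x) \<noteq> 0}"
  have "(\<lambda>x. \<mu> x * (u x)\<^sup>2) summable_on ?S"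
    using u unfolding integrable_V_def by (rule summable_on_subset_banach) auto
  then have "finite ?S"
  proof (rule finite_if_summable_bounded_below)
    show "0 < m * ?d\<^sup>2" using m by simp
    fix x assume x: "x \<in> ?S"
    then have "?d\<^sup>2 \<le> \<bar>u x\<bar>\<^sup>2" by (intro power_mono shrink_nonzero) auto
    then show "m * ?d\<^sup>2 \<le> \<mu> x * (u x)\<^sup>2"
      using m x measure_pos[of x] by (intro mult_mono) auto
  qed
  then show ?thesis by (simp add: C_c_def)
qed

text \<open>
  On a graph whose measure is bounded below, every function of finite \<open>H\<^sup>1\<close> norm is a limit of finitely
  supported ones: the soft thresholdings of \<open>u\<close> have finite support, and the errors tend to zero at
  every vertex while being dominated by the energy density of \<open>u\<close>.  As a consequence a pointwise
  limit obtained by minimisation lies in \<open>H1\<close> as soon as its norm is finite.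
\<close>

lemma H1_iff:
  assumes m: "m > 0" "\<And>x. x \<in> V \<Longrightarrow> m \<le> \<mu> x"
  shows "u \<in> H1 \<longleftrightarrow> integrable_V (grad_sq u) \<and> integrable_V (\<lambda>x. (u x)\<^sup>2)"
proof
  assume "u \<in> H1"
  then obtain \<phi> where \<phi>: "\<phi> \<in> C_c"
      and diff: "integrable_V (\<lambda>x. grad_sq (\<lambda>z. \<phi> z - u z) x + (\<phi> x - u x)\<^sup>2)"
    unfolding H1_def by blast
  let ?d = "\<lambda>z. \<phi> z - u z"
  have d: "integrable_V (grad_sq ?d)" "integrable_V (\<lambda>x. (?d x)\<^sup>2)"
    by (rule integrable_V_bound[OF diff]; simp add: grad_sq_nonneg)+
  have "grad_sq \<phi> \<in> C_c" "(\<lambda>x. (\<phi> x)\<^sup>2) \<in> C_c"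
    using \<Gamma>_finite_support[OF \<phi>, of \<phi>] C_c_mono[OF \<phi>, of "\<lambda>x. (\<phi> x)\<^sup>2"]
    by (simp_all add: grad_sq_def[abs_def])
  note \<phi>_int = this[THEN integrable_V_finite_support]
  show "integrable_V (grad_sq u) \<and> integrable_V (\<lambda>x. (u x)\<^sup>2)"
    using integrable_V_grad_sq_add[OF \<phi>_int(1) d(1), of "-1"]
      integrable_V_square_add[OF \<phi>_int(2) d(2), of "-1"] by simp
next
  assume "integrable_V (grad_sq u) \<and> integrable_V (\<lambda>x. (u x)\<^sup>2)"
  then have u: "integrable_V (grad_sq u)" "integrable_V (\<lambda>x. (u x)\<^sup>2)" by auto
  define \<phi> where "\<phi> n x = shrink n (u x)" for n x
  let ?e = "\<lambda>n x. grad_sq (\<lambda>z. \<phi> n z - u z) x + (\<phi> n x - u x)\<^sup>2"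
  have dom: "\<bar>?e n x\<bar> \<le> grad_sq u x + (u x)\<^sup>2" if "x \<in> V" for n x
  proof -
    have "grad_sq (\<lambda>z. \<phi> n z - u z) x \<le> grad_sq u x"
      using that by (intro grad_sq_mono) (simp_all add: \<phi>_def shrink_contraction)
    moreover have "(\<phi> n x - u x)\<^sup>2 \<le> (u x)\<^sup>2"
      using shrink_contraction(4)[of n "u x"] by (simp add: \<phi>_def abs_le_square_iff)
    ultimately show ?thesis using grad_sq_nonneg[OF that] by (simp add: add_mono)
  qed
  have lim: "(\<lambda>n. \<phi> n x - u x) \<longlonglongrightarrow> 0" for x
    using tendsto_diff[OF shrink_tendsto[of "u x"] tendsto_const[of "u x"]] by (simp add: \<phi>_def)
  have "(\<lambda>n. ?e n x) \<longlonglongrightarrow> grad_sq (\<lambda>_. 0) x + 0\<^sup>2" if "x \<in> V" for x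
    unfolding grad_sq_def using that by (intro tendsto_add tendsto_power \<Gamma>_tendsto lim)
  then have lim_e: "(\<lambda>n. ?e n x) \<longlonglongrightarrow> 0" if "x \<in> V" for x
    using that by (simp add: grad_sq_def \<Gamma>_def)
  have "(\<lambda>n. integral_V (?e n)) \<longlonglongrightarrow> integral_V (\<lambda>_. 0)"
    by (rule integral_V_dominated_convergence[OF integrable_V_add[OF u]]) (use dom lim_e in auto)
  then have "(\<lambda>n. sqrt (integral_V (?e n))) \<longlonglongrightarrow> sqrt 0"
    by (intro tendsto_real_sqrt) (simp add: integral_V_def)
  then have "(\<lambda>n. H1_norm (\<lambda>z. \<phi> n z - u z)) \<longlonglongrightarrow> 0"
    by (simp add: H1_norm_def)
  moreover have "integrable_V (?e n)" for n
    by (rule integrable_V_bound[OF integrable_V_add[OF u] dom])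
  moreover have "\<phi> n \<in> C_c" for n
    using shrink_in_C_c[OF m u(2)] by (simp add: \<phi>_def[abs_def])
  ultimately show "u \<in> H1" unfolding H1_def by blast
qed

end

locale confining_potential = weighted_graph +
  fixes a :: "'a \<Rightarrow> real" and \<mu>_min a\<^sub>0 :: real
  assumes \<mu>_min_pos: "\<mu>_min > 0"
    and \<mu>_ge: "\<And>x. x \<in> V \<Longrightarrow> \<mu>_min \<le> \<mu> x"
    and a\<^sub>0_gt: "-1 < a\<^sub>0"
    and a_ge: "\<And>x. x \<in> V \<Longrightarrow> a\<^sub>0 \<le> a x"
    and sublevel_volume: "\<And>M. M > 0 \<Longrightarrow> \<mu> summable_on {x \<in> V. a x \<le> M}"
begin

text \<open>
  Finite volume and a lower bound on the measure of a vertex leave room for finitely many vertices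
  only.  So the potential tends to infinity at infinity.
\<close>

lemma finite_sublevel: "M > 0 \<Longrightarrow> finite {x \<in> V. a x \<le> M}"
  by (rule finite_if_summable_bounded_below[OF sublevel_volume \<mu>_min_pos]) (auto intro: \<mu>_ge)

lemma countable_V: "countable V"
proof -
  have "\<exists>n. a x \<le> real (Suc n)" for x
  proof -
    obtain n where "a x \<le> real n" using real_arch_simple by blast
    then show ?thesis by (intro exI[of _ n]) simp
  qed
  then have "V \<subseteq> (\<Union>n. {x \<in> V. a x \<le> real (Suc n)})" by blast
  moreover have "countable (\<Union>n. {x \<in> V. a x \<le> real (Suc n)})"
    by (rule countable_UN) (auto intro!: countable_finite[OF finite_sublevel])
  ultimately show ?thesis by (rule countable_subset)
qed

lemma \<D>_iff:
  "u \<in> \<D> a \<longleftrightarrow> integrable_V (grad_sq u) \<and> integrable_V (\<lambda>x. (u x)\<^sup>2) \<and>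
     integrable_V (\<lambda>x. a x * (u x)\<^sup>2) \<and> integrable_V (\<lambda>x. (u x)\<^sup>2 * ln ((u x)\<^sup>2))"
  using integrable_V_abs_iff[of "\<lambda>x. (u x)\<^sup>2 * ln ((u x)\<^sup>2)"]
  by (auto simp: \<D>_def \<H>_def H1_iff[OF \<mu>_min_pos \<mu>_ge] abs_mult)

lemma C_c_subset_\<D>: "\<phi> \<in> C_c \<Longrightarrow> \<phi> \<in> \<D> a"
  unfolding \<D>_iff grad_sq_def[abs_def]
  by (intro conjI integrable_V_finite_support \<Gamma>_finite_support; auto intro: C_c_mono)

lemma \<D>_scale:
  assumes "u \<in> \<D> a" "t \<noteq> 0"
  shows "(\<lambda>x. t * u x) \<in> \<D> a"
proof -
  have u: "integrable_V (grad_sq u)" "integrable_V (\<lambda>x. (u x)\<^sup>2)"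
    "integrable_V (\<lambda>x. a x * (u x)\<^sup>2)" "integrable_V (\<lambda>x. (u x)\<^sup>2 * ln ((u x)\<^sup>2))"
    using assms by (auto simp: \<D>_iff)
  have "integrable_V (\<lambda>x. t\<^sup>2 * grad_sq u x)" "integrable_V (\<lambda>x. t\<^sup>2 * (u x)\<^sup>2)"
    "integrable_V (\<lambda>x. t\<^sup>2 * (a x * (u x)\<^sup>2))"
    "integrable_V (\<lambda>x. t\<^sup>2 * ((u x)\<^sup>2 * ln ((u x)\<^sup>2)) + t\<^sup>2 * ln (t\<^sup>2) * (u x)\<^sup>2)"
    by (intro integrable_V_add integrable_V_cmult u)+
  then show ?thesis
    unfolding \<D>_iff grad_sq_scale[abs_def] square_ln_square_mult[OF assms(2)]
    by (simp add: power_mult_distrib mult.left_commute)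
qed

lemma \<D>_add_C_c:
  assumes "u \<in> \<D> a" "\<phi> \<in> C_c"
  shows "(\<lambda>x. u x + s * \<phi> x) \<in> \<D> a"
proof -
  have u: "integrable_V (grad_sq u)" "integrable_V (\<lambda>x. (u x)\<^sup>2)"
    "integrable_V (\<lambda>x. a x * (u x)\<^sup>2)" "integrable_V (\<lambda>x. (u x)\<^sup>2 * ln ((u x)\<^sup>2))"
    using assms by (auto simp: \<D>_iff)
  have \<phi>: "integrable_V (grad_sq \<phi>)" "integrable_V (\<lambda>x. (\<phi> x)\<^sup>2)"
    using C_c_subset_\<D>[OF assms(2)] by (auto simp: \<D>_iff)
  have fin: "integrable_V (\<lambda>x. f (u x + s * \<phi> x) x)" if "integrable_V (\<lambda>x. f (u x) x)" for f :: "real \<Rightarrow> 'a \<Rightarrow> real"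
  proof -
    have "integrable_V (\<lambda>x. f (u x) x + (f (u x + s * \<phi> x) x - f (u x) x))"
      by (intro integrable_V_add that integrable_V_finite_support C_c_mono[OF assms(2)]) simp
    then show ?thesis by simp
  qed
  show ?thesis
    unfolding \<D>_iff
    using integrable_V_grad_sq_add[OF u(1) \<phi>(1)] integrable_V_square_add[OF u(2) \<phi>(2)]
      fin[of "\<lambda>r x. a x * r\<^sup>2"] fin[of "\<lambda>r x. r\<^sup>2 * ln (r\<^sup>2)"] u by auto
qed

text \<open>
  All integrals in \<open>J'\<close> converge absolutely on \<open>\<D>\<close>, so none of them takes the default value of a
  divergent sum.
\<close>

lemma integrable_V_J':
  assumes "u \<in> \<D> a" "v \<in> \<D> a"
  shows "integrable_V (\<Gamma> u v)" "integrable_V (\<lambda>x. a x * u x * v x)"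
    "integrable_V (\<lambda>x. u x * v x * ln ((u x)\<^sup>2))"
proof -
  have u: "integrable_V (grad_sq u)" "integrable_V (\<lambda>x. (u x)\<^sup>2)"
    "integrable_V (\<lambda>x. \<bar>a x * (u x)\<^sup>2\<bar>)" "integrable_V (\<lambda>x. \<bar>(u x)\<^sup>2 * ln ((u x)\<^sup>2)\<bar>)"
    using assms(1) by (auto simp: \<D>_iff integrable_V_abs_iff)
  have v: "integrable_V (grad_sq v)" "integrable_V (\<lambda>x. (v x)\<^sup>2)"
    "integrable_V (\<lambda>x. \<bar>a x * (v x)\<^sup>2\<bar>)" "integrable_V (\<lambda>x. \<bar>(v x)\<^sup>2 * ln ((v x)\<^sup>2)\<bar>)"
    using assms(2) by (auto simp: \<D>_iff integrable_V_abs_iff)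
  show "integrable_V (\<Gamma> u v)" by (rule integrable_V_\<Gamma>[OF u(1) v(1)])
  show "integrable_V (\<lambda>x. a x * u x * v x)"
  proof (rule integrable_V_bound[OF integrable_V_add[OF u(3) v(3)]])
    fix x
    from mult_left_mono[OF abs_mult_le_sum_squares[of "u x" "v x"], of "\<bar>a x\<bar>"]
    show "\<bar>a x * u x * v x\<bar> \<le> \<bar>a x * (u x)\<^sup>2\<bar> + \<bar>a x * (v x)\<^sup>2\<bar>"
      by (simp add: abs_mult algebra_simps)
  qed
  show "integrable_V (\<lambda>x. u x * v x * ln ((u x)\<^sup>2))"
    by (rule integrable_V_bound[OF integrable_V_add[OF integrable_V_add[OF u(4) v(4)] integrable_V_cmult[OF v(2), of 2]]])
       (use abs_mult_ln_le in \<open>simp add: abs_mult\<close>)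
qed

lemma J'_eq_integral:
  assumes "u \<in> \<D> a" "v \<in> \<D> a"
  shows "J' a u v = integral_V (\<lambda>x. \<Gamma> u v x + a x * u x * v x - u x * v x * ln ((u x)\<^sup>2))"
  unfolding J'_def by (intro integral_V_diff[symmetric] integrable_V_add integrable_V_J'[OF assms])

text \<open>
  Finitely supported test functions suffice: testing with the soft thresholdings of \<open>v\<close> and passing to
  the limit is justified since every integrand stays below one built from \<open>u\<close> and \<open>v\<close>.
\<close>

lemma J'_eq_0_if_C_c:
  assumes u: "u \<in> \<D> a" and zero: "\<And>\<phi>. \<phi> \<in> C_c \<Longrightarrow> J' a u \<phi> = 0" and v: "v \<in> \<D> a"
  shows "J' a u v = 0"
proof -
  define \<phi> where "\<phi> n x = shrink n (v x)" for n x
  let ?j = "\<lambda>w x. \<Gamma> u w x + a x * u x * w x - u x * w x * ln ((u x)\<^sup>2)"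
  let ?g = "\<lambda>x. (1/2) * (grad_sq u x + grad_sq v x) + \<bar>a x * u x * v x\<bar> + \<bar>u x * v x * ln ((u x)\<^sup>2)\<bar>"
  have \<phi>: "\<phi> n \<in> C_c" for n
    using shrink_in_C_c[OF \<mu>_min_pos \<mu>_ge, of v] v by (simp add: \<phi>_def[abs_def] \<D>_iff)
  have "(\<lambda>n. integral_V (?j (\<phi> n))) \<longlonglongrightarrow> integral_V (?j v)"
  proof (rule integral_V_dominated_convergence)
    show "integrable_V ?g"
      using u v by (intro integrable_V_add integrable_V_cmult)
        (auto simp: integrable_V_abs_iff integrable_V_J' \<D>_iff)
  next
    fix n x assume x: "x \<in> V"
    have le: "\<bar>\<phi> n x\<bar> \<le> \<bar>v x\<bar>" by (simp add: \<phi>_def shrink_contraction)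
    have "grad_sq (\<phi> n) x \<le> grad_sq v x"
      using x by (intro grad_sq_mono) (simp_all add: \<phi>_def shrink_contraction)
    then have "\<bar>\<Gamma> u (\<phi> n) x\<bar> \<le> (1/2) * (grad_sq u x + grad_sq v x)"
      using abs_\<Gamma>_le[OF x, of u "\<phi> n"] by simp
    moreover have "\<bar>a x * u x * \<phi> n x\<bar> \<le> \<bar>a x * u x * v x\<bar>"
      using le by (simp add: abs_mult mult_left_mono)
    moreover have "\<bar>u x * \<phi> n x * ln ((u x)\<^sup>2)\<bar> \<le> \<bar>u x * v x * ln ((u x)\<^sup>2)\<bar>"
      using le by (simp add: abs_mult mult_left_mono mult_right_mono)
    ultimately show "\<bar>?j (\<phi> n) x\<bar> \<le> ?g x" by linarith
  next
    fix x assume "x \<in> V"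
    then show "(\<lambda>n. ?j (\<phi> n) x) \<longlonglongrightarrow> ?j v x"
      by (intro tendsto_intros \<Gamma>_tendsto) (auto simp: \<phi>_def shrink_tendsto)
  qed
  moreover have "integral_V (?j (\<phi> n)) = 0" for n
    using zero[OF \<phi>] J'_eq_integral[OF u C_c_subset_\<D>[OF \<phi>]] by simp
  ultimately have "integral_V (?j v) = 0"
    by (simp add: LIMSEQ_const_iff)
  then show ?thesis using J'_eq_integral[OF u v] by simp
qed

end

section \<open>Minimisation at unit mass\<close>

context confining_potential
begin

definition mass :: "('a \<Rightarrow> real) \<Rightarrow> real" where
  "mass u = integral_V (\<lambda>x. (u x)\<^sup>2)"

text \<open>
  The quadratic and logarithmic parts of \<open>2 * J\<close>, without the squared \<open>L\<^sup>2\<close> norm that the norm of \<open>\<H>\<close>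
  includes.  It is the functional that vanishes on the Nehari manifold.
\<close>

definition log_energy :: "('a \<Rightarrow> real) \<Rightarrow> real" where
  "log_energy u = integral_V (\<lambda>x. grad_sq u x + a x * (u x)\<^sup>2 - (u x)\<^sup>2 * ln ((u x)\<^sup>2))"

lemma \<D>_D:
  assumes "u \<in> \<D> a"
  shows "integrable_V (grad_sq u)" "integrable_V (\<lambda>x. (u x)\<^sup>2)"
    "integrable_V (\<lambda>x. a x * (u x)\<^sup>2)" "integrable_V (\<lambda>x. (u x)\<^sup>2 * ln ((u x)\<^sup>2))"
  using assms by (auto simp: \<D>_iff)

lemma J'_self: "u \<in> \<D> a \<Longrightarrow> J' a u u = log_energy u"
  by (simp add: J'_eq_integral log_energy_def grad_sq_def power2_eq_square mult.assoc)

lemma J_eq: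
  assumes "u \<in> \<D> a"
  shows "J a u = (log_energy u + mass u) / 2"
proof -
  note u = \<D>_D[OF assms]
  let ?e = "\<lambda>x. grad_sq u x + (a x + 1) * (u x)\<^sup>2"
  have eq: "?e = (\<lambda>x. grad_sq u x + a x * (u x)\<^sup>2 + (u x)\<^sup>2)"
    by (simp add: algebra_simps)
  have int: "integrable_V ?e" unfolding eq by (intro integrable_V_add u)
  have "0 \<le> integral_V ?e"
  proof (rule integral_V_nonneg)
    fix x assume x: "x \<in> V"
    have "0 \<le> a x + 1" using a_ge[OF x] a\<^sub>0_gt by simp
    then show "0 \<le> ?e x" using grad_sq_nonneg[OF x] by (simp add: add_nonneg_nonneg)
  qed
  then have "J a u = (integral_V ?e - integral_V (\<lambda>x. (u x)\<^sup>2 * ln ((u x)\<^sup>2))) / 2"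
    by (simp add: J_def \<H>_norm_def diff_divide_distrib)
  also have "\<dots> = integral_V (\<lambda>x. ?e x - (u x)\<^sup>2 * ln ((u x)\<^sup>2)) / 2"
    by (simp add: integral_V_diff[OF int u(4)])
  also have "(\<lambda>x. ?e x - (u x)\<^sup>2 * ln ((u x)\<^sup>2))
      = (\<lambda>x. (grad_sq u x + a x * (u x)\<^sup>2 - (u x)\<^sup>2 * ln ((u x)\<^sup>2)) + (u x)\<^sup>2)"
    by (simp add: algebra_simps)
  also have "integral_V \<dots> = log_energy u + mass u"
    unfolding log_energy_def mass_def by (intro integral_V_add integrable_V_diff integrable_V_add u)
  finally show ?thesis .
qed

lemma mass_scale: "mass (\<lambda>x. t * u x) = t\<^sup>2 * mass u"
  by (simp add: mass_def power_mult_distrib integral_V_cmult)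

text \<open>
  The logarithm turns the scaling of a function into an additive multiple of its mass.  Hence every
  ray through a nonzero function contains exactly one point of zero energy, and problems on the Nehari manifold become problems
  on the unit sphere.
\<close>

lemma log_energy_scale:
  assumes "u \<in> \<D> a" "t \<noteq> 0"
  shows "log_energy (\<lambda>x. t * u x) = t\<^sup>2 * (log_energy u - ln (t\<^sup>2) * mass u)"
proof -
  note u = \<D>_D[OF assms(1)]
  have "log_energy (\<lambda>x. t * u x) = integral_V (\<lambda>x. t\<^sup>2 *
      ((grad_sq u x + a x * (u x)\<^sup>2 - (u x)\<^sup>2 * ln ((u x)\<^sup>2)) - ln (t\<^sup>2) * (u x)\<^sup>2))"
    unfolding log_energy_def grad_sq_scale square_ln_square_mult[OF assms(2)]
    by (simp add: power_mult_distrib algebra_simps)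
  also have "\<dots> = t\<^sup>2 * (log_energy u - ln (t\<^sup>2) * mass u)"
    by (simp only: log_energy_def mass_def integral_V_cmult integral_V_diff
        integrable_V_diff integrable_V_add integrable_V_cmult u)
  finally show ?thesis .
qed

lemma mass_ge_point: "u \<in> \<D> a \<Longrightarrow> x \<in> V \<Longrightarrow> \<mu> x * (u x)\<^sup>2 \<le> mass u"
  using sum_le_integral_V[OF \<D>_D(2), of u "{x}"] by (simp add: mass_def)

lemma mass_nonneg: "0 \<le> mass u"
  by (simp add: mass_def integral_V_nonneg)

lemma mass_pos: "u \<in> \<D> a \<Longrightarrow> x \<in> V \<Longrightarrow> u x \<noteq> 0 \<Longrightarrow> 0 < mass u"
  using mass_ge_point[of u x] measure_pos[of x] by (auto elim!: less_le_trans[rotated])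

text \<open>
  The sup bound makes the logarithm bounded above on functions of unit mass.
\<close>

lemma square_le_if_mass_1:
  assumes "u \<in> \<D> a" "mass u = 1" "x \<in> V"
  shows "(u x)\<^sup>2 \<le> 1 / \<mu>_min"
proof -
  have "\<mu>_min * (u x)\<^sup>2 \<le> \<mu> x * (u x)\<^sup>2" using \<mu>_ge[OF assms(3)] by (intro mult_right_mono) auto
  also have "\<dots> \<le> 1" using mass_ge_point[OF assms(1,3)] assms(2) by simp
  finally show ?thesis using \<mu>_min_pos by (simp add: field_simps)
qed

text \<open>
  At unit mass, \<open>log_energy\<close> and the integral of this density differ by a constant only.  The
  constants are chosen such that all three terms are nonnegative at unit mass, so that Fatou's
  lemma applies to each of them.
\<close>

definition pos_density :: "('a \<Rightarrow> real) \<Rightarrow> 'a \<Rightarrow> real" where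
  "pos_density u x = grad_sq u x + (a x + 1) * (u x)\<^sup>2 + (u x)\<^sup>2 * (ln (1 / \<mu>_min) - ln ((u x)\<^sup>2))"

lemma pos_density_parts:
  assumes x: "x \<in> V" and le: "(u x)\<^sup>2 \<le> 1 / \<mu>_min"
  shows "0 \<le> grad_sq u x" "0 \<le> (a x + 1) * (u x)\<^sup>2"
    "0 \<le> (u x)\<^sup>2 * (ln (1 / \<mu>_min) - ln ((u x)\<^sup>2))"
proof -
  show "0 \<le> grad_sq u x" by (rule grad_sq_nonneg[OF x])
  show "0 \<le> (a x + 1) * (u x)\<^sup>2" using a_ge[OF x] a\<^sub>0_gt by simp
  show "0 \<le> (u x)\<^sup>2 * (ln (1 / \<mu>_min) - ln ((u x)\<^sup>2))"
  proof (cases "u x = 0")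
    case False
    then have "ln ((u x)\<^sup>2) \<le> ln (1 / \<mu>_min)"
      using le \<mu>_min_pos by (intro ln_mono) auto
    then show ?thesis by simp
  qed simp
qed

lemma pos_density_integral:
  assumes "u \<in> \<D> a"
  shows "integrable_V (pos_density u)"
    "integral_V (pos_density u) = log_energy u + (1 + ln (1 / \<mu>_min)) * mass u"
proof -
  note u = \<D>_D[OF assms]
  let ?e = "\<lambda>x. grad_sq u x + a x * (u x)\<^sup>2 - (u x)\<^sup>2 * ln ((u x)\<^sup>2)"
  have eq: "pos_density u = (\<lambda>x. ?e x + (1 + ln (1 / \<mu>_min)) * (u x)\<^sup>2)"
    by (simp add: pos_density_def fun_eq_iff algebra_simps)
  show "integrable_V (pos_density u)"
    unfolding eq by (intro integrable_V_add integrable_V_diff integrable_V_cmult u)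
  show "integral_V (pos_density u) = log_energy u + (1 + ln (1 / \<mu>_min)) * mass u"
    unfolding eq log_energy_def mass_def integral_V_cmult[symmetric]
    by (intro integral_V_add integrable_V_add integrable_V_diff integrable_V_cmult u)
qed

lemma pos_density_nonneg:
  assumes "x \<in> V" "(u x)\<^sup>2 \<le> 1 / \<mu>_min"
  shows "0 \<le> pos_density u x"
  using pos_density_parts[of x u, OF assms] by (simp add: pos_density_def)

text \<open>
  Where \<open>a > M\<close>, the density dominates \<open>M * v\<^sup>2\<close>.  So functions of unit mass and bounded energy carry, uniformly,
  almost all of their mass on a finite set, and mass cannot escape to infinity along a minimising
  sequence.
\<close>

lemma mass_on_sublevel:
  assumes v: "v \<in> \<D> a" "mass v = 1" and M: "M > 0"
  shows "1 \<le> (\<Sum>x | x \<in> V \<and> a x \<le> M. \<mu> x * (v x)\<^sup>2) + inverse M * integral_V (pos_density v)"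
proof -
  let ?F = "{x \<in> V. a x \<le> M}"
  let ?f = "\<lambda>x. if x \<in> ?F then (v x)\<^sup>2 else 0"
  have F: "finite ?F" "?F \<subseteq> V" using M by (auto intro: finite_sublevel)
  have f: "?f \<in> C_c" unfolding C_c_def by (auto intro: finite_subset[OF _ F(1)])
  note f_int = integrable_V_finite_support[OF f]
  note pos_density_int = integrable_V_cmult[OF pos_density_integral(1)[OF v(1)], of "inverse M"]
  have "1 = integral_V (\<lambda>x. (v x)\<^sup>2)" using v(2) by (simp add: mass_def)
  also have "\<dots> \<le> integral_V (\<lambda>x. ?f x + inverse M * pos_density v x)"
  proof (rule integral_V_mono[OF \<D>_D(2)[OF v(1)] integrable_V_add[OF f_int pos_density_int]])
    fix x assume x: "x \<in> V"
    note le = square_le_if_mass_1[OF v x]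
    show "(v x)\<^sup>2 \<le> ?f x + inverse M * pos_density v x"
    proof (cases "x \<in> ?F")
      case True
      then show ?thesis using pos_density_nonneg[of x v, OF x le] M by simp
    next
      case False
      then have "M * (v x)\<^sup>2 \<le> (a x + 1) * (v x)\<^sup>2"
        using x by (intro mult_right_mono) auto
      also have "\<dots> \<le> pos_density v x"
        using pos_density_parts[of x v, OF x le] by (simp add: pos_density_def)
      finally have "(v x)\<^sup>2 \<le> inverse M * pos_density v x"
        using M by (simp add: field_simps)
      moreover have "?f x = 0" using False by (rule if_not_P)
      ultimately show ?thesis by linarith
    qed
  qed
  also have "\<dots> = integral_V ?f + inverse M * integral_V (pos_density v)"
    unfolding integral_V_add[OF f_int pos_density_int] integral_V_cmult ..
  also have "integral_V ?f = (\<Sum>x\<in>?F. \<mu> x * ?f x)"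
    by (rule integral_V_finite_support[OF F]) auto
  also have "\<dots> = (\<Sum>x\<in>?F. \<mu> x * (v x)\<^sup>2)"
    by (rule sum.cong) auto
  finally show ?thesis .
qed

lemma unit_mass_nonempty: "\<exists>u\<in>\<D> a. mass u = 1"
proof -
  obtain z where z: "z \<in> V" using vertices_nonempty by blast
  define u where "u x = (if x = z then 1 / sqrt (\<mu> z) else 0)" for x
  have "u \<in> C_c" by (simp add: C_c_def u_def)
  moreover have "mass u = 1"
    unfolding mass_def using integral_V_finite_support[of "{z}" "\<lambda>x. (u x)\<^sup>2"] z measure_pos[OF z]
    by (simp add: u_def power_divide)
  ultimately show ?thesis using C_c_subset_\<D> by blast
qed

text \<open>
  A minimising sequence is bounded at every vertex and \<open>V\<close> is countable, so a subsequence converges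
  pointwise.  Fatou's lemma puts the limit into \<open>\<D>\<close> and bounds its energy by the infimum; the
  concentration of mass on finite sets keeps its mass equal to 1.
\<close>

lemma unit_mass_minimiser_exists:
  "\<exists>u\<in>\<D> a. mass u = 1 \<and> (\<forall>v\<in>\<D> a. mass v = 1 \<longrightarrow> log_energy u \<le> log_energy v)"
proof -
  let ?L = "ln (1 / \<mu>_min)"
  define S where "S = {u \<in> \<D> a. mass u = 1}"
  define m where "m = Inf (log_energy ` S)"
  have S: "u \<in> \<D> a" "mass u = 1" if "u \<in> S" for u using that by (auto simp: S_def)
  have pos_density_S_nonneg: "0 \<le> pos_density u x" if "u \<in> S" "x \<in> V" for u x
    using pos_density_nonneg[of x u, OF that(2) square_le_if_mass_1[OF S[OF that(1)] that(2)]] .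
  have pos_density_S: "integral_V (pos_density u) = log_energy u + (1 + ?L)" if "u \<in> S" for u
    using pos_density_integral(2)[OF S(1)[OF that]] S(2)[OF that] by simp
  have bdd: "bdd_below (log_energy ` S)"
  proof (rule bdd_belowI2)
    fix u assume u: "u \<in> S"
    show "- (1 + ?L) \<le> log_energy u"
      using pos_density_S[OF u] integral_V_nonneg[of "pos_density u"] pos_density_S_nonneg[OF u] by simp
  qed
  have m_le: "m \<le> log_energy u" if "u \<in> S" for u
    unfolding m_def using bdd that by (intro cInf_lower) auto
  have "\<exists>u\<in>S. log_energy u < m + inverse (real (Suc n))" for n
    using cInf_lessD[of "log_energy ` S" "m + inverse (real (Suc n))"] unit_mass_nonempty
    by (auto simp: m_def S_def)
  then obtain w where w: "\<And>n. w n \<in> S" "\<And>n. log_energy (w n) < m + inverse (real (Suc n))"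
    by metis
  have w_bound: "norm (w n x) \<le> sqrt (1 / \<mu>_min)" if "x \<in> V" for n x
    using square_le_if_mass_1[OF S[OF w(1)[of n]] that] by (simp add: real_le_rsqrt)
  obtain k where k: "strict_mono k" "\<And>x. x \<in> V \<Longrightarrow> \<exists>l. (\<lambda>n. w (k n) x) \<longlonglongrightarrow> l"
    by (rule function_convergent_subsequence[OF countable_V, of w "sqrt (1 / \<mu>_min)"])
       (use w_bound that in blast)+
  define u where "u x = lim (\<lambda>n. w (k n) x)" for x
  have lim: "(\<lambda>n. w (k n) x) \<longlonglongrightarrow> u x" if "x \<in> V" for x
    unfolding u_def using k(2)[OF that] by (simp add: convergent_LIMSEQ_iff[symmetric] convergent_def)
  define c where "c n = m + inverse (real (Suc n)) + (1 + ?L)" for n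
  have "c \<longlonglongrightarrow> m + 0 + (1 + ?L)"
    unfolding c_def by (intro tendsto_add tendsto_const LIMSEQ_inverse_real_of_nat)
  then have c: "c \<longlonglongrightarrow> m + (1 + ?L)" by simp
  have le_c: "integral_V (pos_density (w (k n))) \<le> c n" for n
  proof -
    have "inverse (real (Suc (k n))) \<le> inverse (real (Suc n))"
      using seq_suble[OF k(1), of n] by simp
    then show ?thesis
      using w(2)[of "k n"] pos_density_S[OF w(1)[of "k n"]] unfolding c_def by linarith
  qed
  have u_le: "(u x)\<^sup>2 \<le> 1 / \<mu>_min" if "x \<in> V" for x
    by (rule LIMSEQ_le_const2[OF tendsto_power[OF lim[OF that]]])
       (use square_le_if_mass_1[OF S[OF w(1)] that] in auto)
  have cont: "(\<lambda>n. (w (k n) x)\<^sup>2 * ln ((w (k n) x)\<^sup>2)) \<longlonglongrightarrow> (u x)\<^sup>2 * ln ((u x)\<^sup>2)" if "x \<in> V" for x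
    using isCont_tendsto_compose[OF DERIV_isCont[OF DERIV_square_ln_square] lim[OF that]] .
  have pos_density_lim: "(\<lambda>n. pos_density (w (k n)) x) \<longlonglongrightarrow> pos_density u x" if "x \<in> V" for x
    unfolding pos_density_def right_diff_distrib grad_sq_def
    by (intro tendsto_intros \<Gamma>_tendsto lim cont that)
  have int: "integrable_V (pos_density u)" and le_m: "integral_V (pos_density u) \<le> m + (1 + ?L)"
    using integral_V_fatou[of "\<lambda>n. pos_density (w (k n))", OF pos_density_integral(1)[OF S(1)[OF w(1)]]
      pos_density_S_nonneg[OF w(1)] pos_density_lim le_c c] by auto
  \<comment> \<open>The finite integral of the density is split into its three nonnegative parts; the bound
      \<open>a + 1 \<ge> a\<^sub>0 + 1 > 0\<close> recovers the square-integrability of the limit.\<close>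
  have u_D: "u \<in> \<D> a"
  proof -
    note parts = pos_density_parts[of _ u, OF _ u_le]
    have i1: "integrable_V (grad_sq u)"
      by (rule integrable_V_bound[OF int]) (use parts in \<open>simp add: pos_density_def\<close>)
    have i2: "integrable_V (\<lambda>x. (a x + 1) * (u x)\<^sup>2)"
      by (rule integrable_V_bound[OF int], use parts in \<open>simp only: pos_density_def abs_of_nonneg\<close>) simp
    have i3: "integrable_V (\<lambda>x. (u x)\<^sup>2 * (?L - ln ((u x)\<^sup>2)))"
      by (rule integrable_V_bound[OF int], use parts in \<open>simp only: pos_density_def abs_of_nonneg\<close>) simp
    have i4: "integrable_V (\<lambda>x. (u x)\<^sup>2)"
    proof (rule integrable_V_bound[OF integrable_V_cmult[OF i2, of "1 / (a\<^sub>0 + 1)"]])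
      fix x assume "x \<in> V"
      then have "(a\<^sub>0 + 1) * (u x)\<^sup>2 \<le> (a x + 1) * (u x)\<^sup>2"
        using a_ge by (intro mult_right_mono) auto
      then show "\<bar>(u x)\<^sup>2\<bar> \<le> 1 / (a\<^sub>0 + 1) * ((a x + 1) * (u x)\<^sup>2)"
        using a\<^sub>0_gt by (simp add: field_simps)
    qed
    have "integrable_V (\<lambda>x. (a x + 1) * (u x)\<^sup>2 - (u x)\<^sup>2)"
      by (rule integrable_V_diff[OF i2 i4])
    moreover have "integrable_V (\<lambda>x. ?L * (u x)\<^sup>2 - (u x)\<^sup>2 * (?L - ln ((u x)\<^sup>2)))"
      by (rule integrable_V_diff[OF integrable_V_cmult[OF i4] i3])
    ultimately show ?thesis
      unfolding \<D>_iff using i1 i4 by (simp add: algebra_simps)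
  qed
  have "mass u \<le> 1"
    unfolding mass_def
    by (rule integral_V_fatou(2)[of "\<lambda>n x. (w (k n) x)\<^sup>2" _ "\<lambda>_. 1"])
       (use S[OF w(1)] \<D>_D(2) in \<open>auto simp: mass_def intro!: tendsto_power lim\<close>)
  moreover have "1 \<le> mass u"
  proof -
    \<comment> \<open>A bound on all integrals of the density along the sequence, since \<open>c\<close> is decreasing.\<close>
    let ?K = "c 0"
    have c_le: "c n \<le> ?K" for n by (simp add: c_def inverse_le_1_iff)
    have tail: "1 \<le> mass u + ?K * inverse (real (Suc N))" for N
    proof -
      let ?F = "{x \<in> V. a x \<le> real (Suc N)}" and ?i = "inverse (real (Suc N))"
      have F: "finite ?F" "?F \<subseteq> V" by (auto intro: finite_sublevel)
      have "1 \<le> (\<Sum>x\<in>?F. \<mu> x * (w (k n) x)\<^sup>2) + ?K * ?i" for n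
      proof -
        have "?i * integral_V (pos_density (w (k n))) \<le> ?i * ?K"
          using order_trans[OF le_c c_le] by (intro mult_left_mono) auto
        moreover have "?i * ?K = ?K * ?i" by (rule mult.commute)
        ultimately show ?thesis
          using mass_on_sublevel[OF S[OF w(1)[of "k n"]], of "real (Suc N)"] by linarith
      qed
      moreover have "(\<lambda>n. (\<Sum>x\<in>?F. \<mu> x * (w (k n) x)\<^sup>2) + ?K * ?i) \<longlonglongrightarrow> (\<Sum>x\<in>?F. \<mu> x * (u x)\<^sup>2) + ?K * ?i"
        using F by (intro tendsto_intros lim) auto
      ultimately have "1 \<le> (\<Sum>x\<in>?F. \<mu> x * (u x)\<^sup>2) + ?K * ?i"
        by (intro LIMSEQ_le_const) auto
      also have "(\<Sum>x\<in>?F. \<mu> x * (u x)\<^sup>2) \<le> mass u"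
        unfolding mass_def by (intro sum_le_integral_V \<D>_D(2)[OF u_D] F) auto
      finally show ?thesis by simp
    qed
    have "(\<lambda>N. mass u + ?K * inverse (real (Suc N))) \<longlonglongrightarrow> mass u + ?K * 0"
      by (intro tendsto_intros LIMSEQ_inverse_real_of_nat)
    then show ?thesis
      using tail by (intro LIMSEQ_le_const) auto
  qed
  ultimately have u_mass: "mass u = 1" by simp
  have "log_energy u \<le> m"
    using le_m pos_density_integral(2)[OF u_D] u_mass by simp
  then show ?thesis
    using u_D u_mass m_le by (intro bexI[of _ u]) (auto simp: S_def intro: order_trans)
qed

section \<open>The Euler--Lagrange equation and the ground state\<close>

text \<open>
  The minimality on the unit sphere, transported to all of \<open>\<D>\<close> by scaling.  This form has no
  constraint, so it can be differentiated along straight lines.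
\<close>

lemma log_energy_lower_bound:
  assumes min: "\<And>v. v \<in> \<D> a \<Longrightarrow> mass v = 1 \<Longrightarrow> m \<le> log_energy v" and v: "v \<in> \<D> a"
  shows "mass v * (m - ln (mass v)) \<le> log_energy v"
proof (cases "mass v = 0")
  case True
  then have "v x = 0" if "x \<in> V" for x using mass_pos[OF v that] by auto
  then have "log_energy v = integral_V (\<lambda>_. 0)"
    unfolding log_energy_def
    by (intro integral_V_cong) (use neighbour_in_V in \<open>auto simp: grad_sq_def \<Gamma>_def intro!: sum.neutral\<close>)
  then show ?thesis using True by (simp add: integral_V_def)
next
  case False
  then have pos: "0 < mass v" using mass_nonneg[of v] by simp
  define t where "t = 1 / sqrt (mass v)"
  have t: "t \<noteq> 0" "t\<^sup>2 = 1 / mass v" using pos by (simp_all add: t_def power_divide)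
  have "m \<le> log_energy (\<lambda>x. t * v x)"
    using pos by (intro min \<D>_scale v t) (simp add: mass_scale t)
  also have "\<dots> = (log_energy v + ln (mass v) * mass v) / mass v"
    using pos by (simp add: log_energy_scale[OF v t(1)] t(2) ln_div)
  finally show ?thesis using pos by (simp add: field_simps)
qed

text \<open>
  The function \<open>G\<close> in the proof is the gap in the unconstrained inequality along the line
  \<open>u + s * \<phi>\<close>.  It is nonnegative and vanishes at \<open>s = 0\<close>, so its derivative is zero there.  As \<open>\<phi>\<close> has
  finite support, the logarithmic term changes at finitely many vertices only, and no integral has to
  be differentiated.  The derivative of \<open>t\<^sup>2 * ln t\<^sup>2\<close> contributes an extra \<open>2 * t\<close>, which cancels
  against the derivative of the term \<open>n * ln n\<close>.
\<close>

lemma euler_lagrange: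
  assumes u: "u \<in> \<D> a" "mass u = 1"
    and min: "\<And>v. v \<in> \<D> a \<Longrightarrow> mass v = 1 \<Longrightarrow> log_energy u \<le> log_energy v"
    and \<phi>: "\<phi> \<in> C_c"
  shows "J' a u \<phi> = log_energy u * integral_V (\<lambda>x. u x * \<phi> x)"
proof -
  let ?m = "log_energy u" and ?F = "{x \<in> V. \<phi> x \<noteq> 0}"
  let ?h = "\<lambda>t::real. t\<^sup>2 * ln (t\<^sup>2)"
  note iu = \<D>_D[OF u(1)]
  note \<phi>_D = C_c_subset_\<D>[OF \<phi>]
  note i\<phi> = \<D>_D[OF \<phi>_D] and iu\<phi> = integrable_V_J'[OF u(1) \<phi>_D]
  have F: "finite ?F" "?F \<subseteq> V" using \<phi> by (auto simp: C_c_def)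
  define B where "B = integral_V (\<lambda>x. \<Gamma> u \<phi> x + a x * u x * \<phi> x)"
  define B2 where "B2 = integral_V (\<lambda>x. grad_sq \<phi> x + a x * (\<phi> x)\<^sup>2)"
  define b where "b = integral_V (\<lambda>x. u x * \<phi> x)"
  define n where "n s = 1 + 2 * s * b + s\<^sup>2 * mass \<phi>" for s
  define l where "l s = (\<Sum>x\<in>?F. \<mu> x * (?h (u x + s * \<phi> x) - ?h (u x)))" for s
  have mass_eq: "mass (\<lambda>x. u x + s * \<phi> x) = n s" for s
  proof -
    have "mass (\<lambda>x. u x + s * \<phi> x) = integral_V (\<lambda>x. (u x)\<^sup>2 + (2 * s) * (u x * \<phi> x) + s\<^sup>2 * (\<phi> x)\<^sup>2)"
      unfolding mass_def by (intro integral_V_cong) (simp add: power2_eq_square algebra_simps)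
    also have "\<dots> = integral_V (\<lambda>x. (u x)\<^sup>2) + integral_V (\<lambda>x. (2 * s) * (u x * \<phi> x)) + integral_V (\<lambda>x. s\<^sup>2 * (\<phi> x)\<^sup>2)"
      by (simp only: integral_V_add integrable_V_add integrable_V_cmult integrable_V_mult iu i\<phi>)
    finally show ?thesis
      using u(2) unfolding n_def b_def mass_def integral_V_cmult by simp
  qed
  have energy_eq: "log_energy (\<lambda>x. u x + s * \<phi> x) = ?m + (2 * s) * B + s\<^sup>2 * B2 - l s" for s
  proof -
    let ?d = "\<lambda>x. ?h (u x + s * \<phi> x) - ?h (u x)"
    have d: "integrable_V ?d"
      by (intro integrable_V_finite_support C_c_mono[OF \<phi>]) simp
    have "log_energy (\<lambda>x. u x + s * \<phi> x) = integral_V (\<lambda>x.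
        (grad_sq u x + a x * (u x)\<^sup>2 - ?h (u x)) + (2 * s) * (\<Gamma> u \<phi> x + a x * u x * \<phi> x)
        + s\<^sup>2 * (grad_sq \<phi> x + a x * (\<phi> x)\<^sup>2) - ?d x)"
      unfolding log_energy_def grad_sq_add
      by (intro integral_V_cong) (simp add: power2_eq_square algebra_simps)
    also have "\<dots> = integral_V (\<lambda>x. grad_sq u x + a x * (u x)\<^sup>2 - ?h (u x))
        + integral_V (\<lambda>x. (2 * s) * (\<Gamma> u \<phi> x + a x * u x * \<phi> x))
        + integral_V (\<lambda>x. s\<^sup>2 * (grad_sq \<phi> x + a x * (\<phi> x)\<^sup>2)) - integral_V ?d"
      by (simp only: integral_V_diff integral_V_add integrable_V_add integrable_V_diff
          integrable_V_cmult iu i\<phi> iu\<phi> d)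
    also have "integral_V ?d = l s"
      unfolding l_def by (rule integral_V_finite_support[OF F]) auto
    finally show ?thesis
      unfolding integral_V_cmult B_def B2_def log_energy_def by simp
  qed
  define G where "G s = ?m + (2 * s) * B + s\<^sup>2 * B2 - l s - n s * (?m - ln (n s))" for s
  have n0: "n 0 = 1" by (simp add: n_def)
  have dn: "(n has_real_derivative 2 * b) (at 0)"
    unfolding n_def by (auto intro!: derivative_eq_intros)
  have dl: "(l has_real_derivative (\<Sum>x\<in>?F. \<mu> x * ((2 * u x * ln ((u x)\<^sup>2) + 2 * u x) * \<phi> x))) (at 0)"
  proof -
    have "((\<lambda>s. ?h (u x + s * \<phi> x) - ?h (u x)) has_real_derivative
        (2 * u x * ln ((u x)\<^sup>2) + 2 * u x) * \<phi> x) (at 0)" for x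
    proof -
      have "((\<lambda>s. u x + s * \<phi> x) has_real_derivative \<phi> x) (at 0)"
        by (auto intro!: derivative_eq_intros)
      from DERIV_diff[OF DERIV_chain2[OF DERIV_square_ln_square this] DERIV_const[of "?h (u x)"]]
      show ?thesis by (simp only: mult_zero_left add_0_right diff_zero)
    qed
    then show ?thesis
      unfolding l_def by (intro DERIV_sum DERIV_cmult)
  qed
  have dG: "(G has_real_derivative 2 * B
      - (\<Sum>x\<in>?F. \<mu> x * ((2 * u x * ln ((u x)\<^sup>2) + 2 * u x) * \<phi> x))
      - (2 * b * ?m - 2 * b)) (at 0)"
    unfolding G_def by (rule derivative_eq_intros dn dl refl | simp add: n0)+
  moreover have "\<forall>s. \<bar>0 - s\<bar> < 1 \<longrightarrow> G 0 \<le> G s"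
  proof (intro allI impI)
    fix s :: real
    have "n s * (?m - ln (n s)) \<le> ?m + (2 * s) * B + s\<^sup>2 * B2 - l s"
      using log_energy_lower_bound[OF min \<D>_add_C_c[OF u(1) \<phi>], of s]
      unfolding mass_eq energy_eq by simp
    then show "G 0 \<le> G s" by (simp add: G_def n0) (simp add: l_def)
  qed
  ultimately have "2 * B - (\<Sum>x\<in>?F. \<mu> x * ((2 * u x * ln ((u x)\<^sup>2) + 2 * u x) * \<phi> x))
      - (2 * b * ?m - 2 * b) = 0"
    by (intro DERIV_local_min[of G _ 0 1]) auto
  moreover have "(\<Sum>x\<in>?F. \<mu> x * ((2 * u x * ln ((u x)\<^sup>2) + 2 * u x) * \<phi> x))
      = 2 * integral_V (\<lambda>x. u x * \<phi> x * ln ((u x)\<^sup>2)) + 2 * b"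
  proof -
    have "integral_V (\<lambda>x. u x * \<phi> x * ln ((u x)\<^sup>2)) = (\<Sum>x\<in>?F. \<mu> x * (u x * \<phi> x * ln ((u x)\<^sup>2)))"
      "b = (\<Sum>x\<in>?F. \<mu> x * (u x * \<phi> x))"
      unfolding b_def by (rule integral_V_finite_support[OF F]; auto)+
    then show ?thesis
      by (simp add: sum_distrib_left sum.distrib[symmetric] algebra_simps)
  qed
  moreover have "J' a u \<phi> = B - integral_V (\<lambda>x. u x * \<phi> x * ln ((u x)\<^sup>2))"
    by (simp add: J'_def B_def)
  ultimately show ?thesis by (simp add: b_def algebra_simps)
qed

text \<open>
  Multiplying the minimiser by \<open>exp (m / 2)\<close> replaces \<open>ln (u\<^sup>2)\<close> by \<open>ln (u\<^sup>2) + m\<close> and so absorbs the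
  multiplier \<open>m\<close> of the Euler--Lagrange equation.  A weak solution tested with itself has zero
  \<open>log_energy\<close>, so its energy \<open>J\<close> is half its mass, and the unconstrained lower bound says that this
  mass is at least \<open>exp m\<close> if it is not zero.
\<close>

lemma ground_state_exists: "\<exists>u. ground_state_solution a u"
proof -
  obtain u where u: "u \<in> \<D> a" "mass u = 1"
    and min: "\<And>v. v \<in> \<D> a \<Longrightarrow> mass v = 1 \<Longrightarrow> log_energy u \<le> log_energy v"
    using unit_mass_minimiser_exists by blast
  define m where "m = log_energy u"
  define t where "t = exp (m / 2)"
  have t: "t \<noteq> 0" "t\<^sup>2 = exp m"
    by (simp_all add: t_def power2_eq_square exp_add[symmetric])
  define w where "w x = t * u x" for x
  have w: "w \<in> \<D> a" unfolding w_def using \<D>_scale[OF u(1) t(1)] by simp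
  have mass_w: "mass w = exp m" unfolding w_def by (simp add: mass_scale t(2) u(2))
  have "J' a w \<phi> = 0" if \<phi>: "\<phi> \<in> C_c" for \<phi>
  proof -
    note \<phi>_D = C_c_subset_\<D>[OF \<phi>]
    note i = integrable_V_J'[OF u(1) \<phi>_D]
    have iu\<phi>: "integrable_V (\<lambda>x. u x * \<phi> x)"
      by (intro integrable_V_mult \<D>_D(2) u(1) \<phi>_D)
    have log: "w x * \<phi> x * ln ((w x)\<^sup>2) = t * (u x * \<phi> x * ln ((u x)\<^sup>2) + m * (u x * \<phi> x))" for x
      by (cases "u x = 0") (simp_all add: w_def power_mult_distrib ln_mult t algebra_simps)
    have "J' a w \<phi> = integral_V (\<lambda>x. t * (\<Gamma> u \<phi> x + a x * u x * \<phi> x))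
        - integral_V (\<lambda>x. t * (u x * \<phi> x * ln ((u x)\<^sup>2) + m * (u x * \<phi> x)))"
      unfolding J'_def log unfolding w_def \<Gamma>_scale_left by (simp add: algebra_simps)
    also have "\<dots> = t * (J' a u \<phi> - m * integral_V (\<lambda>x. u x * \<phi> x))"
      unfolding J'_def integral_V_cmult integral_V_add[OF i(3) integrable_V_cmult[OF iu\<phi>]]
      by (simp add: algebra_simps)
    also have "\<dots> = 0" using euler_lagrange[OF u min \<phi>] by (simp add: m_def)
    finally show ?thesis .
  qed
  then have weak: "weak_solution a w"
    unfolding weak_solution_def using w J'_eq_0_if_C_c[OF w] by blast
  have nonzero: "nonzero_on_V w"
  proof (rule ccontr)
    assume "\<not> nonzero_on_V w"
    then have "mass w = integral_V (\<lambda>_. 0)"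
      unfolding mass_def nonzero_on_V_def by (intro integral_V_cong) simp
    then show False using mass_w by (simp add: integral_V_def)
  qed
  have J_weak: "J a v = mass v / 2 \<and> log_energy v = 0" if "weak_solution a v" for v
    using that J'_self[of v] J_eq[of v] by (auto simp: weak_solution_def)
  have "J a w \<le> J a v" if v: "weak_solution a v" "nonzero_on_V v" for v
  proof -
    have v_D: "v \<in> \<D> a" using v(1) by (simp add: weak_solution_def)
    have pos: "0 < mass v" using v(2) mass_pos[OF v_D] by (auto simp: nonzero_on_V_def)
    have "mass v * (m - ln (mass v)) \<le> 0"
      using log_energy_lower_bound[OF min v_D] J_weak[OF v(1)] by (simp add: m_def)
    then have "m \<le> ln (mass v)" using pos by (simp add: mult_le_0_iff)
    then have "exp m \<le> mass v" using pos by (simp add: ln_ge_iff)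
    then show ?thesis using J_weak[OF weak] J_weak[OF v(1)] mass_w by simp
  qed
  then show ?thesis
    unfolding ground_state_solution_def using weak nonzero by blast
qed

end

theorem theorem1:
  fixes V :: "'v set" and E :: "'v rel"
    and \<omega> :: "'v \<Rightarrow> 'v \<Rightarrow> real" and \<mu> a :: "'v \<Rightarrow> real"
    and \<mu>_min a\<^sub>0 :: real
  assumes graph: "weighted_graph V E \<omega> \<mu>"
    and mu_min_pos: "\<mu>_min > 0"
    and mu_ge: "\<And>x. x \<in> V \<Longrightarrow> \<mu> x \<ge> \<mu>_min"
    and a0_range: "a\<^sub>0 \<in> {-1<..<0}"
    and A1: "\<And>x. x \<in> V \<Longrightarrow> a x \<ge> a\<^sub>0"
    and A2: "\<And>M. M > 0 \<Longrightarrow> \<mu> summable_on {x \<in> V. a x \<le> M}"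
  shows "\<exists>u. weighted_graph.ground_state_solution V E \<omega> \<mu> a u"
proof -
  interpret weighted_graph V E \<omega> \<mu> by (rule graph)
  interpret confining_potential V E \<omega> \<mu> a \<mu>_min a\<^sub>0
    by unfold_locales (use assms in auto)
  show ?thesis by (rule ground_state_exists)
qed

end
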